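(* Let $\mathbb{F}$ be a field with $|\mathbb{F}|>2$, let $n\ge 3$, and let $V$ be an $n$-dimensional $\mathbb{F}$-vector space, $G=GL(V)$. Then $\mathcal{U}$ and $\mathcal{M}^{\ast}_{(1,-1)}$ are the only nonzero proper $G$-submodules of $\mathcal{K}$. Moreover: (1) if $\operatorname{char}\mathbb{F}\nmid n-1$, then $\mathcal{K}=\mathcal{U}\oplus\mathcal{M}^{\ast}_{(1,-1)}$ is a direct sum of irreducible $G$-modules, and in particular $\mathcal{K}$ has precisely two composition series; (2) if $\operatorname{char}\mathbb{F}\mid n-1$, then $\mathcal{K}$ has the unique composition series $0\subset\mathcal{M}^{\ast}_{(1,-1)}\subset\mathcal{U}\subset\mathcal{K}$.
   Context: $V$ is an $n$-dimensional vector space over $\mathbb{F}$ with a fixed basis $v_1,\dots,v_n$; $G=GL(V)$ acts on $V$ on the left; $\widehat V$ is the dual space of $V$. $\boldsymbol{\Lambda}=\mathbb{F}^{n^3}$ is the space of structure vectors $\boldsymbol{\lambda}=(\lambda_{ijk})_{1\le i,j,k\le n}$; such a vector corresponds to the (not necessarily associative) algebra on $V$ whose bilinear product is $[v_i,v_j]=\sum_k\lambda_{ijk}v_k$. $G$ acts linearly on $\boldsymbol{\Lambda}$ on the right: $\boldsymbol{\lambda}g$ is the structure vector of the product $[u,v]'=g^{-1}[gu,gv]$. $G$-submodules of $\boldsymbol{\Lambda}$ are with respect to this action. Define the following $G$-submodules of $\boldsymbol{\Lambda}$ (where $[\,,\,]$ is the product with structure vector $\boldsymbol{\lambda}$): $\mathcal{K}$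 = all $\boldsymbol{\lambda}$ with $[v,v]=0$ for all $v\in V$; $\mathcal{T}$ = all $\boldsymbol{\lambda}$ such that for every $u\in V$ the linear map $v\mapsto[u,v]$ has trace $0$; $\mathcal{U}=\mathcal{K}\cap\mathcal{T}$; $\mathcal{M}^{\ast}_{(1,-1)}$ = all structure vectors of products of the form $[u,v]=\theta(v)u-\theta(u)v$ with $\theta\in\widehat V$. Characteristic $0$ is regarded as not dividing any nonzero integer. *)

theory Defs
  imports "HOL-Analysis.Analysis"
begin

text \<open>
  A vector space over a field with a basis indexed by the finite type \<open>'n\<close>; its dimension
  is \<open>CARD('n)\<close>.
\<close>

locale based_space = vector_space scale
  for scale :: "'a::field \<Rightarrow> 'b::ab_group_add \<Rightarrow> 'b" +
  fixes v :: "'n::finite \<Rightarrow> 'b"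
  assumes inj_v: "inj v"
    and independent_v: "independent (range v)"
    and span_v: "span (range v) = UNIV"
begin

definition coord :: "'b \<Rightarrow> 'n \<Rightarrow> 'a"
  where "coord x k = representation (range v) x (v k)"

text \<open>
  Structure vectors are elements of \<open>'a ^ ('n \<times> 'n \<times> 'n)\<close>, a vector space under \<open>(*s)\<close>.
  \<open>alg_mult l\<close> is the bilinear product with \<open>[v i, v j] = (\<Sum>k. scale (l $ (i, j, k)) (v k))\<close>, and
  \<open>structure_vector\<close> reads off the structure constants of a product.
\<close>

definition alg_mult :: "'a ^ ('n \<times> 'n \<times> 'n) \<Rightarrow> 'b \<Rightarrow> 'b \<Rightarrow> 'b"
  where "alg_mult l x y =
    (\<Sum>i\<in>UNIV. \<Sum>j\<in>UNIV. \<Sum>k\<in>UNIV. scale (coord x i * coord y j * l $ (i, j, k)) (v k))"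

definition structure_vector :: "('b \<Rightarrow> 'b \<Rightarrow> 'b) \<Rightarrow> 'a ^ ('n \<times> 'n \<times> 'n)"
  where "structure_vector m = vec_lambda (\<lambda>(i, j, k). coord (m (v i) (v j)) k)"

definition GL :: "('b \<Rightarrow> 'b) set"
  where "GL = {g. Vector_Spaces.linear scale scale g \<and> bij g}"

definition act :: "'a ^ ('n \<times> 'n \<times> 'n) \<Rightarrow> ('b \<Rightarrow> 'b) \<Rightarrow> 'a ^ ('n \<times> 'n \<times> 'n)"
  where "act l g = structure_vector (\<lambda>x y. inv g (alg_mult l (g x) (g y)))"

definition submodule :: "('a ^ ('n \<times> 'n \<times> 'n)) set \<Rightarrow> bool"
  where "submodule S \<longleftrightarrow> vec.subspace S \<and> (\<forall>g\<in>GL. \<forall>l\<in>S. act l g \<in> S)"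

definition irreducible_module :: "('a ^ ('n \<times> 'n \<times> 'n)) set \<Rightarrow> bool"
  where "irreducible_module S \<longleftrightarrow> submodule S \<and> S \<noteq> {0} \<and>
    (\<forall>R. submodule R \<and> R \<subseteq> S \<longrightarrow> R = {0} \<or> R = S)"

text \<open>
  A composition series of \<open>M\<close> is a finite strictly increasing chain of submodules from
  \<open>{0}\<close> to \<open>M\<close> into which no further submodule can be inserted.
\<close>

definition composition_series ::
  "('a ^ ('n \<times> 'n \<times> 'n)) set \<Rightarrow> ('a ^ ('n \<times> 'n \<times> 'n)) set list \<Rightarrow> bool"
  where "composition_series M Cs \<longleftrightarrow>
    Cs \<noteq> [] \<and> hd Cs = {0} \<and> last Cs = M \<and> (\<forall>S\<in>set Cs. submodule S) \<and>
    successively (\<lambda>A B. A \<subset> B \<and> \<not> (\<exists>S. submodule S \<and> A \<subset> S \<and> S \<subset> B)) Cs"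

definition linear_trace :: "('b \<Rightarrow> 'b) \<Rightarrow> 'a"
  where "linear_trace f = trace (\<chi> i j. coord (f (v j)) i)"

definition K_mod :: "('a ^ ('n \<times> 'n \<times> 'n)) set"
  where "K_mod = {l. \<forall>x. alg_mult l x x = 0}"

definition T_mod :: "('a ^ ('n \<times> 'n \<times> 'n)) set"
  where "T_mod = {l. \<forall>x. linear_trace (alg_mult l x) = 0}"

definition U_mod :: "('a ^ ('n \<times> 'n \<times> 'n)) set"
  where "U_mod = K_mod \<inter> T_mod"

text \<open>The module \<open>M\<^sup>*\<close> with index \<open>(1, -1)\<close>.\<close>

definition M_mod :: "('a ^ ('n \<times> 'n \<times> 'n)) set"
  where "M_mod = {structure_vector (\<lambda>x y. scale (\<theta> y) x - scale (\<theta> x) y) | \<theta>.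
    Vector_Spaces.linear scale (*) \<theta>}"

end

definition direct_sum :: "'c::ab_group_add set \<Rightarrow> 'c set \<Rightarrow> 'c set \<Rightarrow> bool"
  where "direct_sum S A B \<longleftrightarrow> S = {x + y | x y. x \<in> A \<and> y \<in> B} \<and> A \<inter> B = {0}"

end

theory Submission
  imports Defs
begin

text \<open>
  A transvection with parameter \<open>t\<close> acts on an alternating structure vector \<open>l\<close> as
  \<open>l + t D l + t\<^sup>2 Q l\<close>. Since the field has an element other than \<open>0\<close> and \<open>1\<close>, submodules of
  \<open>K\<close> are closed under every \<open>D\<close> and \<open>Q\<close>. If all elements of a submodule have vanishing
  coefficients at distinct indices, applying some \<open>D\<close> forces it into \<open>M\<close>. Otherwise two operators
  \<open>Q\<close> isolate a single such coefficient, giving the product \<open>v a \<and> v b \<mapsto> v c\<close>; together with its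
  images under \<open>D\<close> and \<open>Q\<close> it spans \<open>U\<close>. Finally \<open>M\<close> and \<open>K / U\<close> (via the trace) are copies of the
  dual space, which is irreducible under transvections. So the submodules of \<open>K\<close> are \<open>0, M, U, K\<close>, and
  \<open>M\<close> lies in \<open>U\<close> or meets it trivially according to the trace \<open>-(n - 1) \<theta>\<close> of its elements.
\<close>

section \<open>Coordinate operators and invariants of structure vectors\<close>

text \<open>
  The coefficients of \<open>t\<close> and \<open>t\<^sup>2\<close> in the action of the transvection \<open>x \<mapsto> x + t x\<^sub>b v\<^sub>a\<close> on an
  alternating \<open>l\<close>.
\<close>

definition transvection_deriv :: "'n \<Rightarrow> 'n \<Rightarrow> 'a::field ^ ('n \<times> 'n \<times> 'n) \<Rightarrow> 'a ^ ('n \<times> 'n \<times> 'n::finite)"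
  where "transvection_deriv a b l = vec_lambda (\<lambda>(i, j, k).
    (if i = b then l $ (a, j, k) else 0) + (if j = b then l $ (i, a, k) else 0)
    - (if k = a then l $ (i, j, b) else 0))"

definition transvection_quad :: "'n \<Rightarrow> 'n \<Rightarrow> 'a::field ^ ('n \<times> 'n \<times> 'n) \<Rightarrow> 'a ^ ('n \<times> 'n \<times> 'n::finite)"
  where "transvection_quad a b l = vec_lambda (\<lambda>(i, j, k).
    - (if i = b \<and> k = a then l $ (a, j, b) else 0) - (if j = b \<and> k = a then l $ (i, a, b) else 0))"

text \<open>For \<open>i \<noteq> j\<close> this is an elementary tensor in (exterior square of the
  dual) tensor V; for \<open>i = j\<close> it is 0.\<close>

definition alt_unit :: "'n \<Rightarrow> 'n \<Rightarrow> 'n \<Rightarrow> 'a::field ^ ('n \<times> 'n \<times> 'n::finite)"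
  where "alt_unit i j k = axis (i, j, k) 1 - axis (j, i, k) 1"

text \<open>The product \<open>[x, y] = \<theta> y x - \<theta> x y\<close>, where \<open>\<theta>\<close> has coefficient vector \<open>c\<close>.\<close>

definition functional_product :: "'a ^ 'n \<Rightarrow> 'a::field ^ ('n \<times> 'n \<times> 'n::finite)"
  where "functional_product c = vec_lambda (\<lambda>(i, j, k). (if i = k then c $ j else 0) - (if j = k then c $ i else 0))"

text \<open>These are the coefficients of the linear form u \<mapsto> tr [u, -]; among alternating
  products its vanishing singles out \<open>U_mod\<close>.\<close>

definition trace_vector :: "'a::field ^ ('n \<times> 'n \<times> 'n) \<Rightarrow> 'a ^ 'n::finite"
  where "trace_vector l = (\<chi> i. \<Sum>j\<in>UNIV. l $ (i, j, j))"

text \<open>The diagonal condition is listed separately because antisymmetry does not imply it in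
  characteristic 2.\<close>

definition alternating :: "'a::field ^ ('n \<times> 'n \<times> 'n::finite) \<Rightarrow> bool"
  where "alternating l \<longleftrightarrow> (\<forall>i k. l $ (i, i, k) = 0) \<and> (\<forall>i j k. l $ (i, j, k) + l $ (j, i, k) = 0)"

lemma alternating_swap: "alternating l \<Longrightarrow> l $ (j, i, k) = - l $ (i, j, k)"
  by (simp add: alternating_def eq_neg_iff_add_eq_0)

lemma vec_triple_eqI: "(\<And>i j k. l $ (i, j, k) = m $ (i, j, k)) \<Longrightarrow> l = m"
  by (simp add: vec_eq_iff)

lemma functional_product_zero: "functional_product 0 = 0"
  by (simp add: functional_product_def vec_eq_iff)

lemma functional_product_add: "functional_product (c + d) = functional_product c + functional_product d"
  by (simp add: functional_product_def vec_eq_iff)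

lemma functional_product_scale: "functional_product (t *s c) = t *s functional_product c"
  by (simp add: functional_product_def vec_eq_iff right_diff_distrib)

lemma trace_vector_add: "trace_vector (l + m) = trace_vector l + trace_vector m"
  by (simp add: trace_vector_def vec_eq_iff sum.distrib)

lemma trace_vector_diff: "trace_vector (l - m) = trace_vector l - trace_vector m"
  by (simp add: trace_vector_def vec_eq_iff sum_subtractf)

lemma trace_vector_scale: "trace_vector (t *s l) = t *s trace_vector l"
  by (simp add: trace_vector_def vec_eq_iff sum_distrib_left)

lemma trace_vector_zero: "trace_vector 0 = 0"
  by (simp add: trace_vector_def vec_eq_iff)

text \<open>In the contracted sum the first summand contributes c_i once and the second contributes
  it n times. The scalar 1 - n decides whether \<open>M_mod\<close> lies in \<open>U_mod\<close> or
  is a complement of it.\<close>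

lemma trace_vector_functional_product:
  "trace_vector (functional_product c :: 'a::field ^ ('n \<times> 'n \<times> 'n::finite))
    = - of_nat (CARD('n) - 1) *s c"
  by (simp add: trace_vector_def functional_product_def vec_eq_iff sum_subtractf of_nat_diff Suc_le_eq algebra_simps)

text \<open>Contracting the last two indices cancels the second term of the operator against the
  third. Only the term changing the first index survives.\<close>

lemma trace_vector_transvection_deriv:
  "trace_vector (transvection_deriv a b l) = axis b (trace_vector l $ a)"
proof -
  have "trace_vector (transvection_deriv a b l) $ i = axis b (trace_vector l $ a) $ i" for i
    by (cases "i = b")
      (simp_all add: trace_vector_def transvection_deriv_def axis_def sum.distrib sum_subtractf)
  then show ?thesis
    by (simp add: vec_eq_iff)
qed

lemma alt_unit_nth:
  "alt_unit i j k $ (x, y, z)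
    = (if x = i \<and> y = j \<and> z = k then 1 else 0) - (if x = j \<and> y = i \<and> z = k then 1 else 0)"
  by (simp add: alt_unit_def axis_def)

lemma trace_vector_alt_unit:
  assumes "i \<noteq> j"
  shows "trace_vector (alt_unit i j k) = (if j = k then axis i 1 else 0) - (if i = k then axis j 1 else (0 :: 'a::field ^ 'n::finite))"
proof -
  have "(\<Sum>m\<in>UNIV. (alt_unit i j k :: 'a ^ ('n \<times> 'n \<times> 'n)) $ (x, m, m))
      = (\<Sum>m\<in>UNIV. (if m = j then if x = i \<and> j = k then 1 else 0 else 0)
          - (if m = i then if x = j \<and> i = k then 1 else 0 else 0))" for x
    by (intro sum.cong refl) (auto simp: alt_unit_nth)
  then show ?thesis
    by (auto simp: trace_vector_def vec_eq_iff sum_subtractf axis_def)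
qed

text \<open>The coefficient vector changes by the same rule as the trace vector, so one
  irreducibility argument on the dual space serves both \<open>M_mod\<close> and the quotient of
  \<open>K_mod\<close> by \<open>U_mod\<close>.\<close>

lemma transvection_deriv_functional_product:
  "transvection_deriv a b (functional_product c) = functional_product (axis b (c $ a))"
  by (auto simp: transvection_deriv_def functional_product_def vec_eq_iff axis_def)

lemma alternating_add: "alternating l \<Longrightarrow> alternating m \<Longrightarrow> alternating (l + m)"
  by (simp add: alternating_def algebra_simps)

lemma alternating_scale: "alternating l \<Longrightarrow> alternating (t *s l)"
  by (simp add: alternating_def distrib_left[symmetric])

lemma alternating_diff: "alternating l \<Longrightarrow> alternating m \<Longrightarrow> alternating (l - m)"
  using alternating_add[of l "- 1 *s m"] alternating_scale[of m "- 1"] by simp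

lemma alternating_alt_unit: "alternating (alt_unit i j k)"
  by (simp add: alternating_def alt_unit_nth conj_commute conj_left_commute)

lemma alternating_functional_product: "alternating (functional_product c)"
  by (auto simp: alternating_def functional_product_def)

lemma alt_unit_swap: "alt_unit j i k = - alt_unit i j k"
  by (simp add: alt_unit_def)

text \<open>Since \<open>w \<noteq> z\<close>, the term that reads the output coefficient at
  \<open>w\<close> vanishes. What remains exchanges a single index, which lets
  \<open>alt_unit_mem\<close> adjust indices one at a time.\<close>

lemma transvection_deriv_alt_unit:
  assumes "x \<noteq> y" "w \<noteq> z"
  shows "transvection_deriv x w (alt_unit x y z) = alt_unit w y z"
proof (rule vec_triple_eqI)
  fix i j k
  show "transvection_deriv x w (alt_unit x y z) $ (i, j, k) = alt_unit w y z $ (i, j, k)"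
    using assms by (cases "i = w"; cases "j = w"; cases "k = x") (simp_all add: transvection_deriv_def alt_unit_nth)
qed

text \<open>Together with \<open>alt_unit_swap\<close> this gives, up to sign, all permutations of
  the three indices.\<close>

lemma transvection_quad_alt_unit:
  assumes "x \<noteq> y"
  shows "transvection_quad x z (alt_unit x y z) = - alt_unit z y x"
proof (rule vec_triple_eqI)
  fix i j k
  show "transvection_quad x z (alt_unit x y z) $ (i, j, k) = (- alt_unit z y x) $ (i, j, k)"
    using assms by (cases "i = z"; cases "j = z"; cases "k = x") (simp_all add: transvection_quad_def alt_unit_nth)
qed

text \<open>Such differences supply the trace-free elements at repeated indices, which linear
  combinations of units with distinct indices cannot reach.\<close>

lemma transvection_deriv_alt_unit_trace:
  assumes "i \<noteq> j" "i \<noteq> k" "j \<noteq> k"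
  shows "transvection_deriv j k (alt_unit i j k) = alt_unit i k k - alt_unit i j j"
proof (rule vec_triple_eqI)
  fix x y z
  show "transvection_deriv j k (alt_unit i j k) $ (x, y, z) = (alt_unit i k k - alt_unit i j j) $ (x, y, z)"
    using assms by (cases "x = k"; cases "y = k"; cases "z = j") (auto simp: transvection_deriv_def alt_unit_nth)
qed

text \<open>As a product, \<open>transvection_quad a c l\<close> is minus the wedge of the
  coordinate form at c with the form y \<mapsto> [v_a, y]_c, with values in the line of v_a. The
  second operator inserts v_b; since v_b has zero coordinate at c, this merely evaluates the form at
  v_b, leaving one coefficient of \<open>l\<close>.\<close>

lemma transvection_quad_quad:
  assumes "alternating l" "a \<noteq> b" "a \<noteq> c" "b \<noteq> c"
  shows "transvection_quad b a (transvection_quad a c l) = - l $ (a, b, c) *s alt_unit a c b"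
proof (rule vec_triple_eqI)
  fix i j k
  show "transvection_quad b a (transvection_quad a c l) $ (i, j, k) = (- l $ (a, b, c) *s alt_unit a c b) $ (i, j, k)"
    using assms(2-) alternating_swap[OF assms(1), of b a c]
    by (cases "i = a"; cases "j = a"; cases "k = b") (simp_all add: transvection_quad_def alt_unit_nth)
qed

section \<open>Subspaces closed under the transvection operators\<close>

definition transvection_closed :: "('a::field ^ ('n \<times> 'n \<times> 'n::finite)) set \<Rightarrow> bool"
  where "transvection_closed S \<longleftrightarrow> vec.subspace S \<and>
    (\<forall>a b. a \<noteq> b \<longrightarrow> (\<forall>l\<in>S. transvection_deriv a b l \<in> S \<and> transvection_quad a b l \<in> S))"

lemma transvection_closedD:
  assumes "transvection_closed S"
  shows "vec.subspace S"
    "a \<noteq> b \<Longrightarrow> l \<in> S \<Longrightarrow> transvection_deriv a b l \<in> S"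
    "a \<noteq> b \<Longrightarrow> l \<in> S \<Longrightarrow> transvection_quad a b l \<in> S"
  using assms by (auto simp: transvection_closed_def)

text \<open>Permuting indices and replacing one index suffice: \<open>i\<close> is brought to the
  first slot, then \<open>j\<close> to the second with \<open>i\<close> kept in place, then
  \<open>k\<close> to the third.\<close>

lemma alt_unit_mem:
  assumes S: "transvection_closed S" and xyz: "distinct [x, y, z]" "alt_unit x y z \<in> S"
    and ijk: "distinct [i, j, k]"
  shows "alt_unit i j k \<in> S"
proof -
  define P where "P x y z \<longleftrightarrow> distinct [x, y, z] \<and> alt_unit x y z \<in> S" for x y z
  have neg: "- l \<in> S \<longleftrightarrow> l \<in> S" for l
    using vec.subspace_neg[OF transvection_closedD(1)[OF S]] by fastforce
  have swap12: "P y x z" if "P x y z" for x y z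
    using that by (auto simp: P_def alt_unit_swap[of y x] neg)
  have swap13: "P z y x" if "P x y z" for x y z
    using that transvection_closedD(3)[OF S, of x z "alt_unit x y z"]
    by (auto simp: P_def transvection_quad_alt_unit neg)
  have swap23: "P x z y" if "P x y z" for x y z
    using that swap12 swap13 by blast
  have repl: "P w y z" if "P x y z" "w \<noteq> y" "w \<noteq> z" for x y z w
    using that transvection_closedD(2)[OF S, of x w "alt_unit x y z"]
    by (cases "x = w") (auto simp: P_def transvection_deriv_alt_unit)
  have repl2: "P x w z" if "P x y z" "w \<noteq> x" "w \<noteq> z" for x y z w
    using that swap12 repl by blast
  have repl3: "P x y w" if "P x y z" "w \<noteq> x" "w \<noteq> y" for x y z w
    using that swap13 repl by blast
  have "P x y z"
    using xyz by (simp add: P_def)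
  \<comment> \<open>If \<open>i\<close> is already \<open>y\<close> or \<open>z\<close>, a swap
    moves it to the front; otherwise it may replace \<open>x\<close>.\<close>
  then obtain y' z' where 1: "P i y' z'"
    using repl[of x y z i] swap12[of x y z] swap13[of x y z] by metis
  obtain z'' where "P i j z''"
  proof (cases "j = z'")
    case True
    then show ?thesis
      using swap23[OF 1] that by blast
  next
    case False
    then show ?thesis
      using repl2[OF 1, of j] ijk that by auto
  qed
  then have "P i j k"
    using repl3[of i j z'' k] ijk by auto
  then show ?thesis
    by (simp add: P_def)
qed

text \<open>Induction on the number of nonzero coefficients. Subtracting an element of
  \<open>S\<close> whose support lies in that of \<open>l\<close>, and which agrees with
  \<open>l\<close> at one nonzero position, shrinks the support.\<close>

lemma alternating_trace_zero_mem:
  fixes l :: "'a::field ^ ('n \<times> 'n \<times> 'n::finite)"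
  assumes S: "transvection_closed S"
    and unit: "\<And>i j k. distinct [i, j, k] \<Longrightarrow> alt_unit i j k \<in> S"
    and l: "alternating l" "trace_vector l = 0"
  shows "l \<in> S"
  using l
proof (induction "card {p. l $ p \<noteq> 0}" arbitrary: l rule: less_induct)
  case less
  note sub = transvection_closedD(1)[OF S]
  have step: "l \<in> S" if d: "d \<in> S" "alternating d" "trace_vector d = 0"
    and supp: "\<And>p. l $ p = 0 \<Longrightarrow> d $ p = 0" and p: "l $ p \<noteq> 0" "d $ p = l $ p" for d p
  proof -
    have "{p. (l - d) $ p \<noteq> 0} \<subseteq> {p. l $ p \<noteq> 0}"
    proof safe
      fix q
      assume "(l - d) $ q \<noteq> 0" "l $ q = 0"
      then show False
        using supp[of q] by simp
    qed
    moreover have "p \<notin> {p. (l - d) $ p \<noteq> 0}" "p \<in> {p. l $ p \<noteq> 0}"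
      using p by simp_all
    ultimately have "{p. (l - d) $ p \<noteq> 0} \<subset> {p. l $ p \<noteq> 0}"
      by blast
    then have "card {p. (l - d) $ p \<noteq> 0} < card {p. l $ p \<noteq> 0}"
      by (intro psubset_card_mono) auto
    then have "l - d \<in> S"
      using less.prems d by (intro less.hyps) (auto simp: alternating_diff trace_vector_diff)
    from vec.subspace_add[OF sub this d(1)] show ?thesis
      by simp
  qed
  note sw = alternating_swap[OF less.prems(1)]
  have l0: "l $ (i, i, k) = 0" for i k
    using less.prems(1) by (simp add: alternating_def)
  consider (zero) "l = 0"
    | (dist) i j k where "distinct [i, j, k]" "l $ (i, j, k) \<noteq> 0"
    | (diag) i j where "l $ (i, j, j) \<noteq> 0"
  proof -
    have "\<exists>i j k. l $ (i, j, k) \<noteq> 0" if "l \<noteq> 0"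
      using that by (auto simp: vec_eq_iff)
    moreover have "l $ (k, j, k) \<noteq> 0 \<Longrightarrow> l $ (j, k, k) \<noteq> 0" for j k
      using sw[of j k k] by auto
    ultimately show ?thesis
      using that l0 by (metis distinct_length_2_or_more distinct_singleton)
  qed
  then show ?case
  proof cases
    case zero
    then show ?thesis
      using vec.subspace_0[OF sub] by simp
  next
    case dist
    let ?d = "l $ (i, j, k) *s alt_unit i j k"
    show ?thesis
    proof (rule step[of ?d "(i, j, k)"])
      show "?d \<in> S"
        using unit[OF dist(1)] sub by (simp add: vec.subspace_scale)
      show "trace_vector ?d = 0"
        using dist(1) by (simp add: trace_vector_scale trace_vector_alt_unit)
      show "?d $ p = 0" if "l $ p = 0" for p
      proof -
        have "l $ (j, i, k) \<noteq> 0"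
          using dist(2) sw[of j i k] by simp
        then have "p \<noteq> (i, j, k)" "p \<noteq> (j, i, k)"
          using that dist(2) by metis+
        then show ?thesis
          by (simp add: alt_unit_def axis_def)
      qed
      show "?d $ (i, j, k) = l $ (i, j, k)"
        using dist(1) by (simp add: alt_unit_nth)
    qed (use dist(2) in \<open>simp_all add: alternating_scale alternating_alt_unit\<close>)
  next
    case diag
    have ij: "i \<noteq> j"
      using diag l0 by auto
    \<comment> \<open>A zero sum with one nonzero term has another, so the unit at \<open>j\<close>
      can be balanced by one at some \<open>m\<close> without leaving the support of
      \<open>l\<close>.\<close>
    have "(\<Sum>m\<in>UNIV. l $ (i, m, m)) = 0"
      using less.prems(2) by (simp add: trace_vector_def vec_eq_iff)
    then have "l $ (i, j, j) + (\<Sum>m\<in>UNIV - {j}. l $ (i, m, m)) = 0"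
      by (simp add: sum.remove[of UNIV j])
    then have "(\<Sum>m\<in>UNIV - {j}. l $ (i, m, m)) \<noteq> 0"
      using diag by auto
    then obtain m where m: "m \<noteq> j" "l $ (i, m, m) \<noteq> 0"
      by (metis (no_types, lifting) DiffD2 singletonI sum.not_neutral_contains_not_neutral)
    have im: "i \<noteq> m"
      using m l0 by auto
    \<comment> \<open>Only the entry at \<open>(i, j, j)\<close> and its mirror are sure to cancel.
      The entry at \<open>(i, m, m)\<close> may change, but it was nonzero already.\<close>
    let ?d = "l $ (i, j, j) *s (alt_unit i j j - alt_unit i m m)"
    show ?thesis
    proof (rule step[of ?d "(i, j, j)"])
      have "transvection_deriv m j (alt_unit i m j) \<in> S"
        using unit[of i m j] ij im m S by (intro transvection_closedD(2)) auto
      then have "alt_unit i j j - alt_unit i m m \<in> S"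
        using ij im m by (simp add: transvection_deriv_alt_unit_trace)
      then show "?d \<in> S"
        by (rule vec.subspace_scale[OF sub])
      show "trace_vector ?d = 0"
        using ij im m by (simp add: trace_vector_scale trace_vector_diff trace_vector_alt_unit)
      show "?d $ p = 0" if "l $ p = 0" for p
      proof -
        have "l $ (j, i, j) \<noteq> 0" "l $ (m, i, m) \<noteq> 0"
          using diag m(2) sw[of j i j] sw[of m i m] by simp_all
        then have "p \<noteq> (i, j, j)" "p \<noteq> (j, i, j)" "p \<noteq> (i, m, m)" "p \<noteq> (m, i, m)"
          using that diag m(2) by metis+
        then show ?thesis
          by (simp add: alt_unit_def axis_def)
      qed
      show "?d $ (i, j, j) = l $ (i, j, j)"
        using ij m by (simp add: alt_unit_nth)
    qed (use diag in \<open>simp_all add: alternating_scale alternating_diff alternating_alt_unit\<close>)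
  qed
qed

text \<open>Suppose all coefficients at distinct indices vanish throughout \<open>S\<close>. Applied
  to \<open>transvection_deriv j k l\<close> at \<open>(i, k, j)\<close>, this says that
  \<open>l $ (i, j, j)\<close> and \<open>l $ (i, k, k)\<close> agree, so these values depend on
  \<open>i\<close> only and determine a functional.\<close>

lemma functional_product_or_distinct_coefficient:
  fixes S :: "('a::field ^ ('n \<times> 'n \<times> 'n::finite)) set"
  assumes S: "transvection_closed S" "\<forall>l\<in>S. alternating l" and n: "CARD('n) \<ge> 2"
    and not_fp: "\<not> S \<subseteq> range functional_product"
  shows "\<exists>l\<in>S. \<exists>a b c. distinct [a, b, c] \<and> l $ (a, b, c) \<noteq> 0"
proof (rule ccontr)
  assume no: "\<not> ?thesis"
  then have zero: "l $ (a, b, c) = 0" if "l \<in> S" "distinct [a, b, c]" for l a b c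
    using that no by blast
  have "\<exists>j. j \<noteq> i" for i :: 'n
  proof (rule ccontr)
    assume "\<nexists>j. j \<noteq> i"
    then have "(UNIV :: 'n set) = {i}"
      by auto
    then show False
      using n by (metis One_nat_def Suc_1 card.empty card.insert empty_iff finite.emptyI not_less_eq_eq order_refl)
  qed
  then obtain p :: "'n \<Rightarrow> 'n" where p: "p i \<noteq> i" for i
    by metis
  have "l \<in> range functional_product" if l: "l \<in> S" for l
  proof -
    have same: "l $ (i, j, j) = l $ (i, k, k)" if "i \<noteq> j" "i \<noteq> k" for i j k
    proof (cases "j = k")
      case False
      then have "transvection_deriv j k l $ (i, k, j) = 0"
        using that l S by (intro zero transvection_closedD(2)) auto
      then show ?thesis
        using that by (simp add: transvection_deriv_def)
    qed simp
    have l0: "l $ (i, i, k) = 0" for i k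
      using S l by (auto simp: alternating_def)
    \<comment> \<open>The double minus matches \<open>functional_product c\<close>, whose
      coefficient at \<open>(i, k, k)\<close> is -c_i.\<close>
    have diag: "l $ (i, k, k) = - (- l $ (i, p i, p i))" if "i \<noteq> k" for i k
      using same[OF that p[of i, symmetric]] by simp
    have "l $ (i, j, k) = functional_product (\<chi> i. - l $ (i, p i, p i)) $ (i, j, k)" for i j k
    proof -
      consider "i = j" | "i \<noteq> j" "i = k" | "i \<noteq> j" "j = k" | "distinct [i, j, k]"
        by auto
      then show ?thesis
      proof cases
        case 2
        have "l $ (i, j, i) = - l $ (j, i, i)"
          using S l by (intro alternating_swap) simp
        also have "\<dots> = - l $ (j, p j, p j)"
          using 2 by (simp add: same[OF _ p[symmetric]])
        finally show ?thesis
          using 2 by (simp add: functional_product_def)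
      next
        case 3
        then show ?thesis
          using diag[of i j] by (simp add: functional_product_def)
      qed (use l0 zero[OF l] in \<open>simp_all add: functional_product_def\<close>)
    qed
    then have "l = functional_product (\<chi> i. - l $ (i, p i, p i))"
      by (rule vec_triple_eqI)
    then show ?thesis
      by blast
  qed
  with not_fp show False
    by blast
qed

text \<open>A nonzero coefficient at \<open>a\<close> produces every unit vector except the one at
  \<open>a\<close>, because the operators need two different indices. The missing one is then
  reached by way of \<open>b\<close>.\<close>

lemma dual_space_irreducible:
  fixes W :: "('a::field ^ 'n::finite) set"
  assumes W: "vec.subspace W" "\<And>c a b. c \<in> W \<Longrightarrow> a \<noteq> b \<Longrightarrow> axis b (c $ a) \<in> W"
    and c: "c \<in> W" "c \<noteq> 0" and n: "CARD('n) \<ge> 2"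
  shows "W = UNIV"
proof -
  obtain a where a: "c $ a \<noteq> 0"
    using c by (auto simp: vec_eq_iff)
  obtain b where b: "b \<noteq> a"
    using n by (metis One_nat_def Suc_1 UNIV_eq_I card.empty card.insert empty_iff finite.emptyI insertI1
        not_less_eq_eq order_refl)
  have other: "axis k 1 \<in> W" if "k \<noteq> a" for k
  proof -
    have "(1 / c $ a) *s axis k (c $ a) \<in> W"
      using W c that by (intro vec.subspace_scale) auto
    moreover have "(1 / c $ a) *s axis k (c $ a) = axis k 1"
      using a by (simp add: vec_eq_iff axis_def)
    ultimately show ?thesis
      by simp
  qed
  have "axis a (axis b 1 $ b) \<in> W"
    using W(2)[OF other[OF b] b] .
  then have units: "axis k 1 \<in> W" for k
    using other by (cases "k = a") auto
  have "x \<in> W" for x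
  proof -
    have "(\<Sum>i\<in>UNIV. x $ i *s axis i 1) \<in> W"
      using W(1) units by (intro vec.subspace_sum vec.subspace_scale)
    then show ?thesis
      by (simp add: basis_expansion)
  qed
  then show ?thesis
    by blast
qed

lemma range_functional_product_subset:
  fixes S :: "('a::field ^ ('n \<times> 'n \<times> 'n::finite)) set"
  assumes S: "transvection_closed S" and n: "CARD('n) \<ge> 2"
    and c: "functional_product c \<in> S" "c \<noteq> 0"
  shows "range functional_product \<subseteq> S"
proof -
  have "{c. functional_product c \<in> S} = UNIV"
  proof (rule dual_space_irreducible)
    show "vec.subspace {c. functional_product c \<in> S}"
      using transvection_closedD(1)[OF S]
      by (simp add: vec.subspace_def functional_product_zero functional_product_add functional_product_scale)
    show "axis b (d $ a) \<in> {c. functional_product c \<in> S}"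
      if "d \<in> {c. functional_product c \<in> S}" "a \<noteq> b" for d a b
      using that transvection_closedD(2)[OF S, of a b "functional_product d"]
      by (simp add: transvection_deriv_functional_product)
  qed (use c n in auto)
  then show ?thesis
    by auto
qed

text \<open>By \<open>trace_vector_transvection_deriv\<close> the image of \<open>S\<close> under
  the trace is stable under the operators in \<open>dual_space_irreducible\<close>.\<close>

lemma trace_vector_surj:
  fixes S :: "('a::field ^ ('n \<times> 'n \<times> 'n::finite)) set"
  assumes S: "transvection_closed S" and n: "CARD('n) \<ge> 2"
    and l: "l \<in> S" "trace_vector l \<noteq> 0"
  shows "trace_vector ` S = UNIV"
proof (rule dual_space_irreducible)
  have sub: "vec.subspace S"
    using transvection_closedD(1)[OF S] .
  show "vec.subspace (trace_vector ` S)"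
    unfolding vec.subspace_def
  proof (intro conjI ballI allI)
    show "0 \<in> trace_vector ` S"
      by (metis image_eqI sub trace_vector_zero vec.subspace_0)
    show "x + y \<in> trace_vector ` S" if "x \<in> trace_vector ` S" "y \<in> trace_vector ` S" for x y
      using that vec.subspace_add[OF sub] by (force simp: trace_vector_add[symmetric])
    show "t *s x \<in> trace_vector ` S" if "x \<in> trace_vector ` S" for t x
      using that vec.subspace_scale[OF sub] by (force simp: trace_vector_scale[symmetric])
  qed
  show "axis b (x $ a) \<in> trace_vector ` S" if "x \<in> trace_vector ` S" "a \<noteq> b" for x a b
    using that transvection_closedD(2)[OF S] by (force simp: trace_vector_transvection_deriv[symmetric])
  show "trace_vector l \<in> trace_vector ` S"
    using l by blast
qed (use l n in auto)

section \<open>Coordinates on V and the modules K, T, U, M in coordinates\<close>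

context based_space
begin

lemma coord_basis: "coord (v i) k = (if i = k then 1 else 0)"
  using inj_v by (auto simp: coord_def representation_basis[OF independent_v] dest: injD)

lemma coord_add: "coord (x + y) k = coord x k + coord y k"
  by (simp add: coord_def representation_add[OF independent_v] span_v)

lemma coord_diff: "coord (x - y) k = coord x k - coord y k"
  by (simp add: coord_def representation_diff[OF independent_v] span_v)

lemma coord_scale: "coord (scale c x) k = c * coord x k"
  by (simp add: coord_def representation_scale[OF independent_v] span_v)

lemma coord_zero: "coord 0 k = 0"
  by (simp add: coord_def representation_zero)

lemma coord_sum: "coord (sum f A) k = (\<Sum>a\<in>A. coord (f a) k)"
  by (induction A rule: infinite_finite_induct) (simp_all add: coord_zero coord_add)

lemma sum_coord: "(\<Sum>i\<in>UNIV. scale (coord x i) (v i)) = x"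
proof -
  have "(\<Sum>i\<in>UNIV. scale (coord x i) (v i)) = (\<Sum>b\<in>range v. scale (representation (range v) x b) b)"
    by (simp add: sum.reindex[OF inj_v] coord_def)
  also have "\<dots> = x"
    by (rule sum_representation_eq[OF independent_v]) (auto simp: span_v)
  finally show ?thesis .
qed

lemma coord_eqI: "(\<And>k. coord x k = coord y k) \<Longrightarrow> x = y"
  by (metis (no_types, lifting) sum.cong sum_coord)

lemmas coord_simps = coord_basis coord_add coord_diff coord_scale coord_zero coord_sum

lemma coord_alg_mult:
  "coord (alg_mult l x y) k = (\<Sum>i\<in>UNIV. \<Sum>j\<in>UNIV. coord x i * coord y j * l $ (i, j, k))"
  by (simp add: alg_mult_def coord_simps if_distrib cong: if_cong)

lemma alg_mult_add_left: "alg_mult l (x + y) z = alg_mult l x z + alg_mult l y z"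
  by (intro coord_eqI) (simp add: coord_alg_mult coord_simps algebra_simps sum.distrib)

lemma alg_mult_add_right: "alg_mult l x (y + z) = alg_mult l x y + alg_mult l x z"
  by (intro coord_eqI) (simp add: coord_alg_mult coord_simps algebra_simps sum.distrib)

lemma alg_mult_scale_left: "alg_mult l (scale c x) y = scale c (alg_mult l x y)"
  by (intro coord_eqI) (simp add: coord_alg_mult coord_simps sum_distrib_left mult_ac)

lemma alg_mult_scale_right: "alg_mult l x (scale c y) = scale c (alg_mult l x y)"
  by (intro coord_eqI) (simp add: coord_alg_mult coord_simps sum_distrib_left mult_ac)

lemma sum_coord_basis: "(\<Sum>i\<in>UNIV. coord (v j) i * f i) = f j"
proof -
  have "(\<Sum>i\<in>UNIV. coord (v j) i * f i) = (\<Sum>i\<in>UNIV. if j = i then f i else 0)"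
    unfolding coord_basis by (intro sum.cong) auto
  then show ?thesis
    by simp
qed

lemma coord_alg_mult_basis: "coord (alg_mult l (v i) (v j)) k = l $ (i, j, k)"
  by (simp add: coord_alg_mult mult.assoc sum_distrib_left[symmetric] sum_coord_basis)

lemma act_nth: "act l g $ (i, j, k) = coord (inv g (alg_mult l (g (v i)) (g (v j)))) k"
  by (simp add: act_def structure_vector_def)

lemma GL_iff:
  "g \<in> GL \<longleftrightarrow> (\<forall>x y. g (x + y) = g x + g y) \<and> (\<forall>c x. g (scale c x) = scale c (g x)) \<and> bij g"
  using vector_space_axioms by (auto simp: GL_def Vector_Spaces.linear_iff)

lemma inv_GL:
  assumes "g \<in> GL"
  shows "inv g (x + y) = inv g x + inv g y" "inv g (scale c x) = scale c (inv g x)"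
    "inv g (g x) = x" "g (inv g x) = x"
proof -
  have g: "g (x + y) = g x + g y" "g (scale c x) = scale c (g x)" "bij g" for c x y
    using assms by (auto simp: GL_iff)
  show i: "inv g (g x) = x" and s: "g (inv g x) = x" for x
    using g(3) by (simp_all add: bij_is_inj bij_is_surj surj_f_inv_f)
  show "inv g (x + y) = inv g x + inv g y"
    by (metis g(1) i s)
  show "inv g (scale c x) = scale c (inv g x)"
    by (metis g(2) i s)
qed

text \<open>Antisymmetry alone would show only that twice the value is 0, which says nothing in
  characteristic 2. An injection into the naturals orders the indices instead: diagonal terms
  vanish, and the terms below the diagonal cancel those above it.\<close>

lemma alternatingD_alg_mult:
  assumes "alternating l"
  shows "alg_mult l x x = 0"
proof (rule coord_eqI)
  fix k
  obtain f :: "'n \<Rightarrow> nat" where f: "inj f"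
    using finite_imp_inj_to_nat_seg[of "UNIV :: 'n set"] by auto
  let ?t = "\<lambda>i j. coord x i * coord x j * l $ (i, j, k)"
  have "coord (alg_mult l x x) k = (\<Sum>i\<in>UNIV. \<Sum>j\<in>UNIV. ?t i j)"
    by (rule coord_alg_mult)
  also have "\<dots> = (\<Sum>i\<in>UNIV. \<Sum>j\<in>UNIV. (if f i < f j then ?t i j else 0) - (if f j < f i then ?t j i else 0))"
  proof (intro sum.cong refl)
    fix i j
    have "f i = f j \<Longrightarrow> i = j"
      using f by (auto dest: injD)
    moreover have "l $ (i, i, k) = 0"
      using assms by (simp add: alternating_def)
    moreover have "?t i j = - ?t j i"
      by (subst alternating_swap[OF assms]) simp
    ultimately show "?t i j = (if f i < f j then ?t i j else 0) - (if f j < f i then ?t j i else 0)"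
      by (cases "f i" "f j" rule: linorder_cases) simp_all
  qed
  also have "\<dots> = (\<Sum>i\<in>UNIV. \<Sum>j\<in>UNIV. if f i < f j then ?t i j else 0)
      - (\<Sum>i\<in>UNIV. \<Sum>j\<in>UNIV. if f j < f i then ?t j i else 0)"
    by (simp only: sum_subtractf)
  also have "(\<Sum>i\<in>UNIV. \<Sum>j\<in>UNIV. if f j < f i then ?t j i else 0)
      = (\<Sum>i\<in>UNIV. \<Sum>j\<in>UNIV. if f i < f j then ?t i j else 0)"
    by (rule sum.swap)
  finally show "coord (alg_mult l x x) k = coord 0 k"
    by (simp add: coord_zero)
qed

lemma K_mod_iff_alternating: "l \<in> K_mod \<longleftrightarrow> alternating l"
proof
  assume "l \<in> K_mod"
  then have sq: "alg_mult l x x = 0" for x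
    by (simp add: K_mod_def)
  have "l $ (i, i, k) = 0" for i k
    using sq[of "v i"] coord_alg_mult_basis[of l i i k] by (simp add: coord_zero)
  moreover have "l $ (i, j, k) + l $ (j, i, k) = 0" for i j k
  proof -
    have "alg_mult l (v i) (v j) + alg_mult l (v j) (v i) = 0"
      using sq[of "v i + v j"] by (simp add: alg_mult_add_left alg_mult_add_right sq add.commute)
    then have "coord (alg_mult l (v i) (v j) + alg_mult l (v j) (v i)) k = 0"
      by (simp only: coord_zero)
    then show ?thesis
      by (simp add: coord_add coord_alg_mult_basis)
  qed
  ultimately show "alternating l"
    by (simp add: alternating_def)
qed (auto simp: K_mod_def alternatingD_alg_mult)

lemma linear_trace_eq: "linear_trace f = (\<Sum>i\<in>UNIV. coord (f (v i)) i)"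
  by (simp add: linear_trace_def trace_def)

lemma linear_trace_conj:
  assumes g: "g \<in> GL" and f: "Vector_Spaces.linear scale scale f"
  shows "linear_trace (inv g \<circ> f \<circ> g) = linear_trace f"
proof -
  let ?m = "\<lambda>h. \<chi> i j. coord (h (v j)) i"
  \<comment> \<open>Only the outer map has to be linear: it is expanded along the coordinates of the
    columns \<open>h' (v j)\<close>.\<close>
  have comp: "?m (h \<circ> h') = ?m h ** ?m h'" if h: "Vector_Spaces.linear scale scale h" for h h'
  proof -
    interpret h: Vector_Spaces.linear scale scale h by (fact h)
    have expand: "coord (h x) i = (\<Sum>k\<in>UNIV. coord (h (v k)) i * coord x k)" for x i
    proof -
      have "h x = (\<Sum>k\<in>UNIV. scale (coord x k) (h (v k)))"
        using h.sum[of "\<lambda>k. scale (coord x k) (v k)" UNIV] by (simp add: sum_coord h.scale)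
      then show ?thesis
        by (simp add: coord_sum coord_scale mult.commute)
    qed
    show ?thesis
      by (simp add: matrix_matrix_mult_def vec_eq_iff expand[of "h' (v j)" for j])
  qed
  have lin: "Vector_Spaces.linear scale scale g" "Vector_Spaces.linear scale scale (inv g)"
    using g inv_GL[OF g] vector_space_axioms by (auto simp: GL_iff Vector_Spaces.linear_iff)
  have "linear_trace (inv g \<circ> (f \<circ> g)) = linear_trace (f \<circ> g \<circ> inv g)"
    unfolding linear_trace_def comp[OF lin(2)] comp[OF Vector_Spaces.linear_compose[OF lin(1) f]]
    by (rule trace_mul_sym)
  also have "f \<circ> g \<circ> inv g = f"
    using inv_GL(4)[OF g] by auto
  finally show ?thesis
    by (simp only: comp_assoc)
qed

lemma linear_alg_mult: "Vector_Spaces.linear scale scale (alg_mult l x)"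
  using vector_space_axioms
  by (simp add: Vector_Spaces.linear_iff alg_mult_add_right alg_mult_scale_right)

lemma trace_vector_nth: "trace_vector l $ i = linear_trace (alg_mult l (v i))"
  by (simp add: trace_vector_def linear_trace_eq coord_alg_mult_basis)

lemma linear_trace_alg_mult: "linear_trace (alg_mult l x) = (\<Sum>i\<in>UNIV. coord x i * trace_vector l $ i)"
proof -
  have "linear_trace (alg_mult l x) = (\<Sum>j\<in>UNIV. \<Sum>i\<in>UNIV. coord x i * l $ (i, j, j))"
  proof -
    have "coord (alg_mult l x (v j)) j = (\<Sum>i\<in>UNIV. coord x i * l $ (i, j, j))" for j
      by (simp add: coord_alg_mult mult.left_commute[of _ "coord (v j) _"] mult.assoc sum_coord_basis)
    then show ?thesis
      by (simp add: linear_trace_eq)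
  qed
  also have "\<dots> = (\<Sum>i\<in>UNIV. \<Sum>j\<in>UNIV. coord x i * l $ (i, j, j))"
    by (rule sum.swap)
  finally show ?thesis
    by (simp add: trace_vector_def sum_distrib_left)
qed

lemma T_mod_iff: "l \<in> T_mod \<longleftrightarrow> trace_vector l = 0"
proof
  assume "l \<in> T_mod"
  then show "trace_vector l = 0"
    by (simp add: T_mod_def vec_eq_iff trace_vector_nth)
qed (simp add: T_mod_def linear_trace_alg_mult)

lemma U_mod_iff: "l \<in> U_mod \<longleftrightarrow> alternating l \<and> trace_vector l = 0"
  by (simp add: U_mod_def K_mod_iff_alternating T_mod_iff)

lemma M_mod_eq: "M_mod = range functional_product"
proof (intro set_eqI iffI)
  fix l :: "'a ^ ('n \<times> 'n \<times> 'n)"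
  assume "l \<in> M_mod"
  then obtain \<theta> where \<theta>: "Vector_Spaces.linear scale (*) \<theta>"
    and l: "l = structure_vector (\<lambda>x y. scale (\<theta> y) x - scale (\<theta> x) y)"
    by (auto simp: M_mod_def)
  have "l = functional_product (\<chi> i. \<theta> (v i))"
    unfolding l by (simp add: functional_product_def structure_vector_def vec_eq_iff coord_simps)
  then show "l \<in> range functional_product"
    by simp
next
  fix l :: "'a ^ ('n \<times> 'n \<times> 'n)"
  assume "l \<in> range functional_product"
  then obtain c :: "'a ^ 'n" where l: "l = functional_product c"
    by blast
  define \<theta> where "\<theta> x = (\<Sum>i\<in>UNIV. coord x i * c $ i)" for x
  have "Vector_Spaces.linear scale (*) \<theta>"
  proof -
    have "vector_space ((*) :: 'a \<Rightarrow> 'a \<Rightarrow> 'a)"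
      by unfold_locales (simp_all add: algebra_simps)
    then show ?thesis
      using vector_space_axioms
      by (simp add: Vector_Spaces.linear_iff \<theta>_def coord_add coord_scale distrib_right sum.distrib
          sum_distrib_left mult.assoc)
  qed
  moreover have "\<theta> (v i) = c $ i" for i
    by (simp add: \<theta>_def sum_coord_basis)
  then have "l = structure_vector (\<lambda>x y. scale (\<theta> y) x - scale (\<theta> x) y)"
    unfolding l by (simp add: functional_product_def structure_vector_def vec_eq_iff coord_simps)
  ultimately show "l \<in> M_mod"
    by (auto simp: M_mod_def)
qed

lemma alg_mult_functional_product:
  "\<exists>\<theta>. \<forall>x y. alg_mult (functional_product c) x y = scale (\<theta> y) x - scale (\<theta> x) y"
proof (intro exI allI coord_eqI)
  fix x y k
  define \<theta> where "\<theta> x = (\<Sum>i\<in>UNIV. coord x i * c $ i)" for x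
  have "coord (alg_mult (functional_product c) x y) k =
      (\<Sum>i\<in>UNIV. \<Sum>j\<in>UNIV. (if i = k then coord x i * coord y j * c $ j else 0))
      - (\<Sum>i\<in>UNIV. \<Sum>j\<in>UNIV. (if j = k then coord x i * coord y j * c $ i else 0))"
    unfolding coord_alg_mult sum_subtractf[symmetric]
    by (intro sum.cong refl) (simp add: functional_product_def algebra_simps)
  also have "(\<Sum>i\<in>UNIV. \<Sum>j\<in>UNIV. (if i = k then coord x i * coord y j * c $ j else 0)) = coord x k * \<theta> y"
    by (subst sum.swap) (simp add: \<theta>_def sum_distrib_left mult.assoc)
  also have "(\<Sum>i\<in>UNIV. \<Sum>j\<in>UNIV. (if j = k then coord x i * coord y j * c $ i else 0)) = \<theta> x * coord y k"
    by (simp add: \<theta>_def sum_distrib_left sum_distrib_right mult_ac)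
  finally show "coord (alg_mult (functional_product c) x y) k
      = coord (scale ((\<lambda>x. \<Sum>i\<in>UNIV. coord x i * c $ i) y) x
        - scale ((\<lambda>x. \<Sum>i\<in>UNIV. coord x i * c $ i) x) y) k"
    by (simp add: coord_simps \<theta>_def mult.commute)
qed

section \<open>Invariance of K, U, M and 0 under the general linear group\<close>

lemma submodule_K_mod: "submodule K_mod"
  unfolding submodule_def
proof (intro conjI ballI)
  show "vec.subspace K_mod"
    by (auto simp: vec.subspace_def K_mod_iff_alternating alternating_def distrib_left[symmetric]
        add.assoc add.left_commute)
  fix g l
  assume g: "g \<in> GL" and l: "l \<in> K_mod"
  have sq: "alg_mult l x x = 0" for x
    using l by (simp add: K_mod_def)
  \<comment> \<open>The sign is written as a scalar so that homogeneity of \<open>inv g\<close>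
    carries it outside.\<close>
  have anti: "alg_mult l y x = scale (- 1) (alg_mult l x y)" for x y
    using sq[of "x + y"] by (simp add: alg_mult_add_left alg_mult_add_right sq add_eq_0_iff2 add.commute)
  have "inv g 0 = 0"
    using inv_GL(2)[OF g, of 0 0] by simp
  then have "act l g $ (i, i, k) = 0" for i k
    by (simp add: act_nth sq coord_zero)
  moreover have "act l g $ (i, j, k) + act l g $ (j, i, k) = 0" for i j k
    unfolding act_nth anti[of "g (v i)"] inv_GL(2)[OF g] coord_scale by simp
  ultimately show "act l g \<in> K_mod"
    by (simp add: K_mod_iff_alternating alternating_def)
qed

text \<open>Left multiplication by \<open>v i\<close> in \<open>act l g\<close> is the conjugate by
  \<open>g\<close> of left multiplication by \<open>g (v i)\<close> in \<open>l\<close>, and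
  conjugation preserves the trace.\<close>

lemma submodule_U_mod: "submodule U_mod"
  unfolding submodule_def
proof (intro conjI ballI)
  have "vec.subspace T_mod"
    by (auto simp: vec.subspace_def T_mod_iff trace_vector_def vec_eq_iff sum.distrib
        sum_distrib_left[symmetric])
  then show "vec.subspace U_mod"
    using submodule_K_mod unfolding U_mod_def by (intro vec.subspace_inter) (simp_all add: submodule_def)
  fix g l
  assume g: "g \<in> GL" and l: "l \<in> U_mod"
  have "linear_trace (alg_mult l (g (v i))) = 0" for i
    using l by (simp add: U_mod_def T_mod_def)
  then have "linear_trace (inv g \<circ> alg_mult l (g (v i)) \<circ> g) = 0" for i
    by (simp add: linear_trace_conj[OF g linear_alg_mult])
  then have "act l g \<in> T_mod"
    by (simp add: T_mod_iff trace_vector_def act_nth vec_eq_iff linear_trace_eq)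
  moreover have "act l g \<in> K_mod"
    using submodule_K_mod g l by (auto simp: submodule_def U_mod_def)
  ultimately show "act l g \<in> U_mod"
    by (simp add: U_mod_def)
qed

lemma submodule_M_mod: "submodule M_mod"
  unfolding submodule_def
proof (intro conjI ballI)
  show "vec.subspace M_mod"
    unfolding vec.subspace_def
  proof (intro conjI ballI allI)
    show "0 \<in> M_mod"
      unfolding M_mod_eq functional_product_zero[symmetric] by blast
  qed (auto simp: M_mod_eq functional_product_add[symmetric] functional_product_scale[symmetric])
  fix g l
  assume g: "g \<in> GL" and l: "l \<in> M_mod"
  obtain \<theta> where \<theta>: "\<And>x y. alg_mult l x y = scale (\<theta> y) x - scale (\<theta> x) y"
    using l alg_mult_functional_product unfolding M_mod_eq by blast
  have inv_diff: "inv g (x - y) = inv g x - inv g y" for x y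
    using inv_GL(1)[OF g, of "x - y" y] by simp
  \<comment> \<open>The action pulls the functional \<theta> back along \<open>g\<close>.\<close>
  have "act l g = functional_product (\<chi> i. \<theta> (g (v i)))"
    by (simp add: vec_eq_iff act_nth \<theta> inv_diff inv_GL(2,3)[OF g] functional_product_def coord_simps)
  then show "act l g \<in> M_mod"
    unfolding M_mod_eq by blast
qed

lemma submodule_zero: "submodule {0}"
proof -
  have "act 0 g = 0" if g: "g \<in> GL" for g
  proof -
    have "inv g 0 = 0"
      using inv_GL(2)[OF g, of 0 0] by simp
    moreover have "alg_mult 0 x y = 0" for x y
      by (simp add: alg_mult_def)
    ultimately show ?thesis
      by (simp add: vec_eq_iff act_nth coord_zero)
  qed
  then show ?thesis
    by (simp add: submodule_def)
qed

section \<open>Transvections in the group and the list of submodules of K\<close>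

lemma act_transvection:
  assumes ab: "a \<noteq> b" and l: "alternating l"
  shows "\<exists>g\<in>GL. act l g = l + t *s transvection_deriv a b l + (t * t) *s transvection_quad a b l"
proof (intro bexI)
  define g where "g x = x + scale (t * coord x b) (v a)" for x
  define h where "h x = x - scale (t * coord x b) (v a)" for x
  \<comment> \<open>As \<open>a \<noteq> b\<close>, the shift along \<open>v a\<close> does not
    change the coordinate at \<open>b\<close>, so reversing its sign inverts it.\<close>
  have gh: "g (h x) = x" "h (g x) = x" for x
    using ab by (simp_all add: g_def h_def coord_simps)
  then have bij: "bij g"
    by (metis bijI')
  then show "(\<lambda>x. x + scale (t * coord x b) (v a)) \<in> GL"
    by (auto simp: GL_iff g_def[abs_def] coord_simps algebra_simps)
  have inv: "inv g = h"
    using gh by (intro inv_equality) auto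
  have gv: "g (v i) = v i + scale (if i = b then t else 0) (v a)" for i
    by (simp add: g_def coord_simps)
  have coord_h: "coord (h x) k = coord x k - (if k = a then t * coord x b else 0)" for x k
    by (simp add: h_def coord_simps)
  \<comment> \<open>For \<open>i = j = b\<close> the expansion also contains t squared times
    [v_a, v_a], which is 0. This removes the cubic term that \<open>inv g\<close> would create from
    it.\<close>
  have gg: "coord (alg_mult l (g (v i)) (g (v j))) k = l $ (i, j, k)
      + (if i = b then t * l $ (a, j, k) else 0) + (if j = b then t * l $ (i, a, k) else 0)" for i j k
    using l by (simp add: gv alg_mult_add_left alg_mult_add_right alg_mult_scale_left alg_mult_scale_right
        coord_simps coord_alg_mult_basis alternating_def)
  have l0: "l $ (i, i, k) = 0" for i k
    using l by (simp add: alternating_def)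
  have act: "act l g $ (i, j, k) = (l + t *s transvection_deriv a b l + (t * t) *s transvection_quad a b l) $ (i, j, k)"
    for i j k
    using ab
    by (cases "i = b"; cases "j = b"; cases "k = a")
      (simp_all add: act_nth inv coord_h gg l0
        transvection_deriv_def transvection_quad_def algebra_simps)
  have "act l g = l + t *s transvection_deriv a b l + (t * t) *s transvection_quad a b l"
    using act by (simp add: vec_eq_iff)
  then show "act l (\<lambda>x. x + scale (t * coord x b) (v a))
      = l + t *s transvection_deriv a b l + (t * t) *s transvection_quad a b l"
    unfolding g_def[abs_def] .
qed

text \<open>Two distinct nonzero parameters \<open>1\<close> and \<open>s\<close> separate the linear and quadratic coefficients.\<close>

lemma submodule_transvection:
  assumes S: "submodule S" "S \<subseteq> K_mod" and ab: "a \<noteq> b" and s: "s \<noteq> (0::'a)" "s \<noteq> 1" and l: "l \<in> S"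
  shows "transvection_deriv a b l \<in> S" "transvection_quad a b l \<in> S"
proof -
  let ?D = "transvection_deriv a b l" and ?Q = "transvection_quad a b l"
  have sub: "vec.subspace S"
    using S(1) by (simp add: submodule_def)
  have alt: "alternating l"
    using l S(2) by (auto simp: K_mod_iff_alternating)
  have in_S: "t *s ?D + (t * t) *s ?Q \<in> S" for t
  proof -
    obtain g where "g \<in> GL" "act l g = l + t *s ?D + (t * t) *s ?Q"
      using act_transvection[OF ab alt] by blast
    then have "l + t *s ?D + (t * t) *s ?Q \<in> S"
      using S(1) l by (metis submodule_def)
    from vec.subspace_diff[OF sub this l] show ?thesis
      by (simp add: algebra_simps)
  qed
  have "s * s - s \<noteq> 0"
    using s by (simp add: algebra_simps)
  moreover have "(s *s ?D + (s * s) *s ?Q) - s *s (1 *s ?D + (1 * 1) *s ?Q) = (s * s - s) *s ?Q"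
    by (simp add: vec_eq_iff algebra_simps)
  ultimately have "?Q = (1 / (s * s - s)) *s ((s *s ?D + (s * s) *s ?Q) - s *s (1 *s ?D + (1 * 1) *s ?Q))"
    by (simp add: vec_eq_iff divide_simps) (simp add: algebra_simps)
  also have "\<dots> \<in> S"
    using in_S[of s] in_S[of 1] by (intro vec.subspace_scale vec.subspace_diff sub)
  finally show Q: "?Q \<in> S" .
  show "?D \<in> S"
    using vec.subspace_diff[OF sub in_S[of 1] Q] by simp
qed

lemma submodule_transvection_closed:
  assumes "submodule S" "S \<subseteq> K_mod" "\<exists>s. s \<noteq> (0::'a) \<and> s \<noteq> 1"
  shows "transvection_closed S"
proof -
  have "vec.subspace S"
    using assms(1) by (simp add: submodule_def)
  then show ?thesis
    using assms submodule_transvection[OF assms(1,2)] by (auto simp: transvection_closed_def)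
qed

lemma alt_unit_in_U_mod: "distinct [a, b, c] \<Longrightarrow> alt_unit a b c \<in> U_mod"
  by (simp add: U_mod_iff alternating_alt_unit trace_vector_alt_unit)

lemma alt_unit_notin_M_mod: "distinct [a, b, c] \<Longrightarrow> alt_unit a b c \<notin> M_mod"
proof
  assume abc: "distinct [a, b, c]" and "alt_unit a b c \<in> M_mod"
  then obtain d :: "'a ^ 'n" where "alt_unit a b c = functional_product d"
    by (auto simp: M_mod_eq)
  then have "(alt_unit a b c :: 'a ^ ('n \<times> 'n \<times> 'n)) $ (a, b, c) = functional_product d $ (a, b, c)"
    by simp
  then show False
    using abc by (simp add: alt_unit_nth functional_product_def)
qed

lemma M_mod_subset_K_mod: "M_mod \<subseteq> K_mod"
  by (auto simp: M_mod_eq K_mod_iff_alternating alternating_functional_product)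

text \<open>Inside \<open>M_mod\<close>, irreducibility of the dual space leaves two choices.
  Otherwise \<open>S\<close> contains \<open>U_mod\<close>, and the same irreducibility applied to
  traces leaves two more.\<close>

lemma submodule_K_mod_cases:
  assumes S: "submodule S" "S \<subseteq> K_mod" and field: "\<exists>s. s \<noteq> (0::'a) \<and> s \<noteq> 1" and n: "CARD('n) \<ge> 2"
  shows "S \<in> {{0}, M_mod, U_mod, K_mod}"
proof (cases "S \<subseteq> M_mod")
  note closed = submodule_transvection_closed[OF S field]
  have sub: "vec.subspace S"
    using S by (simp add: submodule_def)
  case True
  show ?thesis
  proof (cases "S \<subseteq> {0}")
    case True
    then show ?thesis
      using vec.subspace_0[OF sub] by auto
  next
    case False
    then obtain c where "functional_product c \<in> S" "functional_product c \<noteq> 0"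
      using \<open>S \<subseteq> M_mod\<close> unfolding M_mod_eq by blast
    then have "M_mod \<subseteq> S"
      unfolding M_mod_eq using functional_product_zero
      by (intro range_functional_product_subset[OF closed n]) auto
    then show ?thesis
      using \<open>S \<subseteq> M_mod\<close> by simp
  qed
next
  note closed = submodule_transvection_closed[OF S field]
  have sub: "vec.subspace S"
    using S by (simp add: submodule_def)
  case False
  have alt: "\<forall>l\<in>S. alternating l"
    using S(2) by (auto simp: K_mod_iff_alternating)
  obtain l a b c where l: "l \<in> S" "distinct [a, b, c]" "l $ (a, b, c) \<noteq> 0"
    using functional_product_or_distinct_coefficient[OF closed alt n] False unfolding M_mod_eq by blast
  have "transvection_quad b a (transvection_quad a c l) \<in> S"
    using l by (intro transvection_closedD(3)[OF closed]) auto
  then have "- l $ (a, b, c) *s alt_unit a c b \<in> S"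
    using l alt by (simp add: transvection_quad_quad)
  then have "(- 1 / l $ (a, b, c)) *s (- l $ (a, b, c) *s alt_unit a c b) \<in> S"
    by (rule vec.subspace_scale[OF sub])
  then have acb: "alt_unit a c b \<in> S"
    using l(3) by simp
  have unit: "alt_unit i j k \<in> S" if "distinct [i, j, k]" for i j k
    using l(2) by (intro alt_unit_mem[OF closed _ acb that]) auto
  have U: "U_mod \<subseteq> S"
    using alternating_trace_zero_mem[OF closed unit] by (auto simp: U_mod_iff)
  show ?thesis
  proof (cases "S \<subseteq> U_mod")
    case True
    then show ?thesis
      using U by simp
  next
    case False
    then obtain m where "m \<in> S" "m \<notin> U_mod"
      by blast
    then have m: "m \<in> S" "trace_vector m \<noteq> 0"
      using alt by (simp_all add: U_mod_iff)
    have "k \<in> S" if k: "k \<in> K_mod" for k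
    proof -
      have "trace_vector k \<in> trace_vector ` S"
        using trace_vector_surj[OF closed n m] by simp
      then obtain x where x: "x \<in> S" "trace_vector k = trace_vector x"
        by blast
      \<comment> \<open>Elements of \<open>K_mod\<close> with equal traces differ by an element of
        \<open>U_mod\<close>, which \<open>S\<close> contains.\<close>
      have "k - x \<in> U_mod"
        using k x alt by (simp add: U_mod_iff K_mod_iff_alternating alternating_diff trace_vector_diff)
      then have "k - x + x \<in> S"
        using U x by (intro vec.subspace_add[OF sub]) auto
      then show ?thesis
        by simp
    qed
    then show ?thesis
      using S(2) by blast
  qed
qed

section \<open>Composition series of K as chains among four submodules\<close>

lemma composition_series_subset:
  assumes Cs: "composition_series M Cs" and S: "S \<in> set Cs"
  shows "S \<subseteq> M"
proof -
  \<comment> \<open>The definition places only the last term at \<open>M\<close>; by transitivity,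
    strict growth puts every other term below it.\<close>
  have "successively (\<subset>) Cs"
  proof (rule successively_mono)
    show "successively (\<lambda>A B. A \<subset> B \<and> \<not> (\<exists>S. submodule S \<and> A \<subset> S \<and> S \<subset> B)) Cs"
      using Cs by (simp add: composition_series_def)
  qed simp
  then have sorted: "sorted_wrt (\<subset>) Cs"
    by (subst (asm) successively_conv_sorted_wrt) (auto simp: transp_def)
  have Cs_eq: "Cs = butlast Cs @ [M]"
    using Cs by (auto simp: composition_series_def)
  have "sorted_wrt (\<subset>) (butlast Cs @ [M])"
    using sorted Cs_eq by simp
  moreover have "S \<in> set (butlast Cs @ [M])"
    using S Cs_eq by simp
  ultimately show ?thesis
    by (auto simp: sorted_wrt_append)
qed

text \<open>This turns the count of composition series into a finite order problem. A submodule
  strictly below a member of \<open>X\<close> lies in \<open>K_mod\<close>, hence is itself in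
  \<open>X\<close>, so insertions need be tested only there.\<close>

lemma composition_series_K_mod_iff:
  assumes "\<exists>s. s \<noteq> (0::'a) \<and> s \<noteq> 1" "CARD('n) \<ge> 2"
  defines "X \<equiv> {{0}, M_mod, U_mod, K_mod}"
  shows "composition_series K_mod Cs \<longleftrightarrow>
    Cs \<noteq> [] \<and> hd Cs = {0} \<and> last Cs = K_mod \<and> set Cs \<subseteq> X \<and>
    successively (\<lambda>A B. A \<subset> B \<and> (\<forall>S\<in>X. \<not> (A \<subset> S \<and> S \<subset> B))) Cs"
proof -
  have X: "S \<in> X \<longleftrightarrow> submodule S \<and> S \<subseteq> K_mod" for S
    using submodule_K_mod_cases[OF _ _ assms(1,2)] submodule_zero submodule_M_mod submodule_U_mod
      submodule_K_mod M_mod_subset_K_mod vec.subspace_0[of K_mod] submodule_K_mod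
    by (auto simp: X_def U_mod_def submodule_def)
  have sub: "(\<forall>S\<in>set Cs. submodule S) \<and> set Cs \<subseteq> X \<longleftrightarrow> set Cs \<subseteq> X"
    using X by blast
  have cover: "(\<exists>S. submodule S \<and> A \<subset> S \<and> S \<subset> B) \<longleftrightarrow> (\<exists>S\<in>X. A \<subset> S \<and> S \<subset> B)"
    if "B \<in> X" for A B
  proof -
    have "S \<in> X \<longleftrightarrow> submodule S" if "S \<subset> B" for S
      using that \<open>B \<in> X\<close> unfolding X by auto
    then show ?thesis
      by auto
  qed
  have succ: "successively (\<lambda>A B. A \<subset> B \<and> \<not> (\<exists>S. submodule S \<and> A \<subset> S \<and> S \<subset> B)) Cs \<longleftrightarrow>
      successively (\<lambda>A B. A \<subset> B \<and> (\<forall>S\<in>X. \<not> (A \<subset> S \<and> S \<subset> B))) Cs"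
    if "set Cs \<subseteq> X"
  proof (intro successively_cong refl)
    fix A B
    assume "B \<in> set Cs"
    then have "B \<in> X"
      using that by blast
    from cover[OF this, of A] show "(A \<subset> B \<and> \<not> (\<exists>S. submodule S \<and> A \<subset> S \<and> S \<subset> B)) \<longleftrightarrow>
        (A \<subset> B \<and> (\<forall>S\<in>X. \<not> (A \<subset> S \<and> S \<subset> B)))"
      by simp
  qed
  have "set Cs \<subseteq> X" if "composition_series K_mod Cs"
  proof
    fix S
    assume "S \<in> set Cs"
    then show "S \<in> X"
      using that composition_series_subset[OF that] by (simp add: X composition_series_def)
  qed
  then have "composition_series K_mod Cs \<longleftrightarrow> composition_series K_mod Cs \<and> set Cs \<subseteq> X"
    by blast
  also have "\<dots> \<longleftrightarrow> Cs \<noteq> [] \<and> hd Cs = {0} \<and> last Cs = K_mod \<and> set Cs \<subseteq> X \<and>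
    successively (\<lambda>A B. A \<subset> B \<and> (\<forall>S\<in>X. \<not> (A \<subset> S \<and> S \<subset> B))) Cs"
  proof (cases "set Cs \<subseteq> X")
    case True
    then show ?thesis
      using sub unfolding composition_series_def succ[OF True] by simp
  qed simp
  finally show ?thesis .
qed

section \<open>Strict inclusions and the two cases for the characteristic\<close>

lemma submodule_inclusions:
  assumes "CARD('n) \<ge> 3"
  shows "{0} \<subset> M_mod" "{0} \<subset> U_mod" "M_mod \<subset> K_mod" "U_mod \<subset> K_mod" "\<not> U_mod \<subseteq> M_mod"
proof -
  obtain A :: "'n set" where "card A = 3"
    using obtain_subset_with_card_n[OF assms] by blast
  then obtain a b c :: 'n where abc: "distinct [a, b, c]"
    by (auto simp: card_3_iff)
  have U: "alt_unit a b c \<in> U_mod" and nM: "alt_unit a b c \<notin> M_mod"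
    using alt_unit_in_U_mod[OF abc] alt_unit_notin_M_mod[OF abc] .
  have zero: "0 \<in> M_mod" "0 \<in> U_mod"
    using submodule_M_mod submodule_U_mod by (auto simp: submodule_def vec.subspace_0)
  show nUM: "\<not> U_mod \<subseteq> M_mod"
    using U nM by blast
  show "{0} \<subset> U_mod"
  proof -
    have "U_mod \<noteq> {0}"
      using nUM zero(1) by force
    then show ?thesis
      using zero(2) by blast
  qed
  have "functional_product (axis a 1) $ (b, a, b) = (1 :: 'a)"
    using abc by (simp add: functional_product_def axis_def)
  then have "functional_product (axis a 1 :: 'a ^ 'n) \<noteq> 0"
    by (metis zero_index zero_neq_one)
  moreover have "functional_product (axis a 1) \<in> M_mod"
    unfolding M_mod_eq by (rule rangeI)
  ultimately show "{0} \<subset> M_mod"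
    using zero(1) by blast
  show "M_mod \<subset> K_mod"
    using M_mod_subset_K_mod nUM unfolding U_mod_def by blast
  \<comment> \<open>Its trace vector is the unit vector at \<open>a\<close>, so \<open>U_mod\<close>
    is proper in every characteristic.\<close>
  have "trace_vector (alt_unit a b b :: 'a ^ ('n \<times> 'n \<times> 'n)) $ a = 1"
    using abc by (simp add: trace_vector_alt_unit axis_def)
  then have "trace_vector (alt_unit a b b :: 'a ^ ('n \<times> 'n \<times> 'n)) \<noteq> 0"
    by (metis zero_index zero_neq_one)
  then have "alt_unit a b b \<in> K_mod - U_mod"
    by (simp add: U_mod_iff K_mod_iff_alternating alternating_alt_unit)
  then show "U_mod \<subset> K_mod"
    unfolding U_mod_def by blast
qed

lemma direct_sum_U_mod_M_mod:
  assumes "\<not> CHAR('a) dvd CARD('n) - 1"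
  shows "direct_sum K_mod U_mod M_mod"
  unfolding direct_sum_def
proof
  define m :: 'a where "m = of_nat (CARD('n) - 1)"
  have m: "m \<noteq> 0"
    \<comment> \<open>In characteristic 0 divisibility means n - 1 = 0, in agreement with the
      convention.\<close>
    unfolding m_def of_nat_eq_0_iff_char_dvd by (fact assms)
  have trace: "trace_vector (functional_product c :: 'a ^ ('n \<times> 'n \<times> 'n)) = - m *s c" for c
    by (simp only: trace_vector_functional_product m_def)
  show "U_mod \<inter> M_mod = {0}"
  proof
    show "U_mod \<inter> M_mod \<subseteq> {0}"
    proof
      fix l
      assume "l \<in> U_mod \<inter> M_mod"
      then obtain c where c: "l = functional_product c" "- m *s c = 0"
        unfolding M_mod_eq by (auto simp: U_mod_iff trace)
      then have "c = 0"
        using m by (simp add: vec_eq_iff)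
      then show "l \<in> {0}"
        by (simp add: c functional_product_zero)
    qed
    show "{0} \<subseteq> U_mod \<inter> M_mod"
      using submodule_M_mod submodule_U_mod by (auto simp: submodule_def vec.subspace_0)
  qed
  show "K_mod = {x + y |x y. x \<in> U_mod \<and> y \<in> M_mod}"
  proof safe
    fix l
    assume l: "l \<in> K_mod"
    \<comment> \<open>The trace multiplies coefficient vectors of \<open>M_mod\<close> by -m, so
      this \<open>y\<close> is the element of \<open>M_mod\<close> with the same trace as
      \<open>l\<close>.\<close>
    define y where "y = functional_product ((- 1 / m) *s trace_vector l)"
    have "trace_vector y = trace_vector l"
      using m by (simp add: y_def trace vec_eq_iff)
    then have "l - y \<in> U_mod"
      using l by (simp add: U_mod_iff K_mod_iff_alternating trace_vector_diff alternating_diff y_def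
          alternating_functional_product)
    moreover have "y \<in> M_mod"
      by (simp add: y_def M_mod_eq)
    ultimately show "\<exists>x y. l = x + y \<and> x \<in> U_mod \<and> y \<in> M_mod"
      by (metis diff_add_cancel)
  next
    fix x y
    assume "x \<in> U_mod" "y \<in> M_mod"
    then show "x + y \<in> K_mod"
      using M_mod_subset_K_mod by (auto simp: U_mod_iff K_mod_iff_alternating alternating_add)
  qed
qed

lemma M_mod_subset_U_mod:
  assumes "CHAR('a) dvd CARD('n) - 1"
  shows "M_mod \<subseteq> U_mod"
proof -
  have "of_nat (CARD('n) - 1) = (0 :: 'a)"
    using assms by (simp only: of_nat_eq_0_iff_char_dvd)
  then show ?thesis
    by (simp only: M_mod_eq U_mod_iff image_subset_iff alternating_functional_product
        trace_vector_functional_product) simp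
qed

end

text \<open>\<open>CARD\<close> of an infinite type is 0, which is why the size condition is a
  disjunction.\<close>

lemma two_nontrivial_elements:
  assumes "infinite (UNIV :: 'a::zero_neq_one set) \<or> CARD('a) > 2"
  shows "\<exists>s. s \<noteq> (0::'a) \<and> s \<noteq> 1"
proof (rule ccontr)
  assume "\<not> ?thesis"
  then have UNIV_eq: "(UNIV :: 'a set) = {0, 1}"
    by auto
  have "finite (UNIV :: 'a set) \<and> CARD('a) = 2"
    unfolding UNIV_eq by simp
  then show False
    using assms by simp
qed

section \<open>Covering chains in four-element orders\<close>

lemma covering_chains_diamond:
  fixes z m u k :: "'c::order"
  defines "R \<equiv> \<lambda>A B. A < B \<and> (\<forall>S\<in>{z, m, u, k}. \<not> (A < S \<and> S < B))"
  assumes less: "z < m" "z < u" "m < k" "u < k" and incomparable: "\<not> m < u" "\<not> u < m" "m \<noteq> u"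
  shows "Cs \<noteq> [] \<and> hd Cs = z \<and> last Cs = k \<and> set Cs \<subseteq> {z, m, u, k} \<and> successively R Cs
    \<longleftrightarrow> Cs \<in> {[z, m, k], [z, u, k]}" (is "?L \<longleftrightarrow> ?R")
proof -
  have zk: "z < k"
    using less by simp
  have not_less: "\<not> m < z" "\<not> u < z" "\<not> k < m" "\<not> k < u" "\<not> k < z"
    using less zk by (simp_all add: less_le_not_le)
  have neq: "z \<noteq> m" "z \<noteq> u" "z \<noteq> k" "m \<noteq> k" "u \<noteq> k"
    using less zk by auto
  \<comment> \<open>These are the four edges of the Hasse diagram, along which the list is then
    traced from \<open>z\<close>.\<close>
  have X: "R A B \<longleftrightarrow> A = z \<and> B \<in> {m, u} \<or> A \<in> {m, u} \<and> B = k"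
    if "A \<in> {z, m, u, k}" "B \<in> {z, m, u, k}" for A B
    using that unfolding R_def
    by (elim insertE emptyE) (simp_all add: less zk incomparable not_less neq neq[symmetric] incomparable(3)[symmetric])
  have dist: "distinct [z, m, u, k]"
    using neq incomparable by simp
  show ?thesis
  proof
    assume L: ?L
    then obtain x r where Cs: "Cs = z # x # r"
      using dist by (cases Cs; cases "tl Cs") auto
    then have x: "x = m \<or> x = u"
      using L X[of z x] dist by auto
    then obtain y r' where r: "r = y # r'"
      using L Cs dist by (cases r) auto
    then have y: "y = k"
      using L Cs x X[of x y] dist by auto
    \<comment> \<open>Nothing covers the top element, so the list stops there.\<close>
    have "r' = []"
      using L Cs r y X[of k "hd r'"] dist by (cases r') auto
    then show ?R
      using Cs r x y by auto
  next
    assume ?R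
    then show ?L
      using X[of z m] X[of z u] X[of m k] X[of u k] by auto
  qed
qed

lemma covering_chains_linear:
  fixes z m u k :: "'c::order"
  defines "R \<equiv> \<lambda>A B. A < B \<and> (\<forall>S\<in>{z, m, u, k}. \<not> (A < S \<and> S < B))"
  assumes less: "z < m" "m < u" "u < k"
  shows "Cs \<noteq> [] \<and> hd Cs = z \<and> last Cs = k \<and> set Cs \<subseteq> {z, m, u, k} \<and> successively R Cs
    \<longleftrightarrow> Cs = [z, m, u, k]" (is "?L \<longleftrightarrow> ?R")
proof -
  have less': "z < u" "m < k" "z < k"
    using less by (meson less_trans)+
  have not_less: "\<not> m < z" "\<not> u < z" "\<not> k < m" "\<not> k < u" "\<not> k < z" "\<not> u < m"
    using less less' by (simp_all add: less_le_not_le)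
  have neq: "z \<noteq> m" "z \<noteq> u" "z \<noteq> k" "m \<noteq> k" "u \<noteq> k" "m \<noteq> u"
    using less less' by auto
  \<comment> \<open>Here the Hasse diagram is a path, so each term has at most one possible
    successor.\<close>
  have X: "R A B \<longleftrightarrow> A = z \<and> B = m \<or> A = m \<and> B = u \<or> A = u \<and> B = k"
    if "A \<in> {z, m, u, k}" "B \<in> {z, m, u, k}" for A B
    using that unfolding R_def
    by (elim insertE emptyE) (simp_all add: less less' not_less neq neq[symmetric])
  have dist: "distinct [z, m, u, k]"
    using neq by simp
  show ?thesis
  proof
    assume L: ?L
    then obtain x r where Cs: "Cs = z # x # r"
      using dist by (cases Cs; cases "tl Cs") auto
    then have x: "x = m"
      using L X[of z x] dist by auto
    then obtain y r' where r: "r = y # r'"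
      using L Cs dist by (cases r) auto
    then have y: "y = u"
      using L Cs x X[of x y] dist by auto
    then obtain w r'' where r': "r' = w # r''"
      using L Cs r dist by (cases r') auto
    then have w: "w = k"
      using L Cs r x y X[of y w] dist by auto
    have "r'' = []"
      using L Cs r r' w X[of k "hd r''"] dist by (cases r'') auto
    then show ?R
      using Cs r r' x y w by auto
  next
    assume ?R
    then show ?L
      using X[of z m] X[of m u] X[of u k] by auto
  qed
qed

theorem mainTheorem1:
  fixes scale :: "'a::field \<Rightarrow> 'b::ab_group_add \<Rightarrow> 'b"
    and v :: "'n::finite \<Rightarrow> 'b"
  assumes "based_space scale v"
    and "infinite (UNIV :: 'a set) \<or> CARD('a) > 2"
    and "CARD('n) \<ge> 3"
  shows "{S. based_space.submodule scale v S \<and> S \<subseteq> based_space.K_mod scale v \<and>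
             S \<noteq> {0} \<and> S \<noteq> based_space.K_mod scale v}
         = {based_space.U_mod scale v, based_space.M_mod scale v} \<and>
    (\<not> CHAR('a) dvd CARD('n) - 1 \<longrightarrow>
       direct_sum (based_space.K_mod scale v) (based_space.U_mod scale v)
         (based_space.M_mod scale v) \<and>
       based_space.irreducible_module scale v (based_space.U_mod scale v) \<and>
       based_space.irreducible_module scale v (based_space.M_mod scale v) \<and>
       card {Cs. based_space.composition_series scale v (based_space.K_mod scale v) Cs} = 2) \<and>
    (CHAR('a) dvd CARD('n) - 1 \<longrightarrow>
       {Cs. based_space.composition_series scale v (based_space.K_mod scale v) Cs}
       = {[{0}, based_space.M_mod scale v, based_space.U_mod scale v, based_space.K_mod scale v]})"
proof -
  interpret based_space scale v
    by (fact assms(1))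
  have field: "\<exists>s. s \<noteq> (0::'a) \<and> s \<noteq> 1"
    using assms(2) by (rule two_nontrivial_elements)
  have n2: "CARD('n) \<ge> 2"
    using assms(3) by simp
  let ?X = "{{0}, M_mod, U_mod, K_mod}"
  note incl = submodule_inclusions[OF assms(3)]
  note cases = submodule_K_mod_cases[OF _ _ field n2]
  note series = composition_series_K_mod_iff[OF field n2]
  have dist: "distinct [{0}, M_mod, U_mod, K_mod]"
    using incl by auto
  have "{S. submodule S \<and> S \<subseteq> K_mod \<and> S \<noteq> {0} \<and> S \<noteq> K_mod} = {U_mod, M_mod}"
  proof
    show "{S. submodule S \<and> S \<subseteq> K_mod \<and> S \<noteq> {0} \<and> S \<noteq> K_mod} \<subseteq> {U_mod, M_mod}"
      using cases by blast
    show "{U_mod, M_mod} \<subseteq> {S. submodule S \<and> S \<subseteq> K_mod \<and> S \<noteq> {0} \<and> S \<noteq> K_mod}"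
      using incl submodule_U_mod submodule_M_mod by blast
  qed
  moreover have "direct_sum K_mod U_mod M_mod \<and> irreducible_module U_mod \<and> irreducible_module M_mod \<and>
      card {Cs. composition_series K_mod Cs} = 2" if "\<not> CHAR('a) dvd CARD('n) - 1"
  proof -
    have ds: "direct_sum K_mod U_mod M_mod"
      using that by (rule direct_sum_U_mod_M_mod)
    \<comment> \<open>\<open>M_mod\<close> is nonzero and meets \<open>U_mod\<close> only in
      0.\<close>
    then have nMU: "\<not> M_mod \<subseteq> U_mod"
      using incl(1) by (auto simp: direct_sum_def)
    have "R = {0} \<or> R = U_mod" if "submodule R" "R \<subseteq> U_mod" for R
    proof -
      have "R \<in> ?X"
        using that incl(4) by (intro cases) auto
      then show ?thesis
        using that incl(4) nMU by auto
    qed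
    then have "irreducible_module U_mod"
      using incl(2) submodule_U_mod by (auto simp: irreducible_module_def)
    moreover have "R = {0} \<or> R = M_mod" if "submodule R" "R \<subseteq> M_mod" for R
    proof -
      have "R \<in> ?X"
        using that incl(3) by (intro cases) auto
      then show ?thesis
        using that incl(3,5) by auto
    qed
    then have "irreducible_module M_mod"
      using incl(1) submodule_M_mod by (auto simp: irreducible_module_def)
    \<comment> \<open>\<open>nMU\<close> and \<open>incl(5)\<close> make \<open>M_mod\<close> and
      \<open>U_mod\<close> incomparable, giving the diamond.\<close>
    moreover have "composition_series K_mod Cs \<longleftrightarrow> Cs \<in> {[{0}, M_mod, K_mod], [{0}, U_mod, K_mod]}" for Cs
      unfolding series using incl nMU by (intro covering_chains_diamond) auto
    then have "{Cs. composition_series K_mod Cs} = {[{0}, M_mod, K_mod], [{0}, U_mod, K_mod]}"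
      by blast
    then have "card {Cs. composition_series K_mod Cs} = 2"
      using dist by simp
    ultimately show ?thesis
      using ds by blast
  qed
  moreover have "{Cs. composition_series K_mod Cs} = {[{0}, M_mod, U_mod, K_mod]}"
    if "CHAR('a) dvd CARD('n) - 1"
  proof -
    have MU: "M_mod \<subset> U_mod"
      using M_mod_subset_U_mod[OF that] incl(5) by blast
    have "composition_series K_mod Cs \<longleftrightarrow> Cs = [{0}, M_mod, U_mod, K_mod]" for Cs
      unfolding series using incl(1,4) MU by (intro covering_chains_linear)
    then show ?thesis
      by blast
  qed
  ultimately show ?thesis
    by blast
qed

end
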